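(* Let $H_n$ be the pyrene system with $n$ pyrene fragments, and let $Af(H_0,x)=1$. Then $Af(H_1,x)=2x^3+2x^2+2x$ and for all $n\ge2$, $$Af(H_n,x)=(2x^3+2x^2+2x)Af(H_{n-1},x)-x^2Af(H_{n-2},x).$$
   Context: Pyrene system: draw the hexagonal lattice so that every hexagon has two vertical sides; horizontally adjacent hexagons then share a vertical edge. For $n\ge1$, $H_n$ is the hexagonal system (the plane graph formed by the vertices and edges of the following $4n$ hexagons) consisting of a horizontal linear row of $2n$ hexagons $h_{1,1},h_{1,2},\dots,h_{n,1},h_{n,2}$, consecutive ones sharing a vertical edge, together with, for each $i$, a hexagon $s_{i,1}$ directly above and a hexagon $s_{i,2}$ directly below the common edge of $h_{i,1}$ and $h_{i,2}$ (each sharing an edge with both $h_{i,1}$ and $h_{i,2}$). $H_0$ is the null graph. For a perfect matching $M$ of $G$, an anti-forcing set of $M$ is a set $S\subseteq E(G)\setminus M$ such that $M$ is the unique perfect matching of $G-S$; the anti-forcing number $af(G,M)$ is the minimum size of an anti-forcing set of $M$. The anti-forcing polynomial is $Af(G,x)=\sum_{M\in\mathcal{M}(G)}x^{af(G,M)}$, where $\mathcal{M}(G)$ is the set of perfect matchings of $G$. *)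

theory Defs
  imports "HOL-Computational_Algebra.Polynomial"
begin

text \<open>Coordinates: the hexagonal lattice is drawn with vertical hexagon sides.
A point (x,y) of the plane is encoded by the integer pair (X,Y) with
X = 2x/sqrt 3 and Y = 2y (unit side length).  The hexagon with centre (X,Y)
has the six vertices (X+1,Y+1),(X,Y+2),(X-1,Y+1),(X-1,Y-1),(X,Y-2),(X+1,Y-1);
its vertical sides are the edges at abscissa X+1 and X-1.\<close>

type_synonym vertex = "int \<times> int"
type_synonym edge = "vertex set"

definition hex_edges :: "int \<times> int \<Rightarrow> edge set" where
  "hex_edges c = (case c of (X, Y) \<Rightarrow>
     {{(X+1,Y+1),(X,Y+2)}, {(X,Y+2),(X-1,Y+1)}, {(X-1,Y+1),(X-1,Y-1)},
      {(X-1,Y-1),(X,Y-2)}, {(X,Y-2),(X+1,Y-1)}, {(X+1,Y-1),(X+1,Y+1)}})"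

text \<open>Hexagon centres of the pyrene system H_n: the horizontal row
h_{1,1},h_{1,2},...,h_{n,1},h_{n,2} has centres (2j,0), j = 0..2n-1
(h_{i,1} at j = 2i-2, h_{i,2} at j = 2i-1); their common vertical edge lies at
abscissa 4i-3, and s_{i,1}, s_{i,2} have centres (4i-3, 3) and (4i-3, -3).\<close>

definition pyrene_centres :: "nat \<Rightarrow> (int \<times> int) set" where
  "pyrene_centres n =
     {(2*j, 0) | j. 0 \<le> j \<and> j < 2 * int n}
     \<union> {(4*i-3, 3) | i. 1 \<le> i \<and> i \<le> int n}
     \<union> {(4*i-3, -3) | i. 1 \<le> i \<and> i \<le> int n}"

definition pyrene_E :: "nat \<Rightarrow> edge set" where
  "pyrene_E n = \<Union> (hex_edges ` pyrene_centres n)"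

definition pyrene_V :: "nat \<Rightarrow> vertex set" where
  "pyrene_V n = \<Union> (pyrene_E n)"

definition perfect_matching :: "'a set \<Rightarrow> 'a set set \<Rightarrow> 'a set set \<Rightarrow> bool" where
  "perfect_matching V E M \<longleftrightarrow> M \<subseteq> E \<and> (\<forall>v\<in>V. \<exists>!e. e \<in> M \<and> v \<in> e)"

definition perfect_matchings :: "'a set \<Rightarrow> 'a set set \<Rightarrow> 'a set set set" where
  "perfect_matchings V E = {M. perfect_matching V E M}"

definition anti_forcing_set :: "'a set \<Rightarrow> 'a set set \<Rightarrow> 'a set set \<Rightarrow> 'a set set \<Rightarrow> bool" where
  "anti_forcing_set V E M S \<longleftrightarrow> S \<subseteq> E - M \<and> perfect_matchings V (E - S) = {M}"

definition af :: "'a set \<Rightarrow> 'a set set \<Rightarrow> 'a set set \<Rightarrow> nat" where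
  "af V E M = (LEAST k. \<exists>S. anti_forcing_set V E M S \<and> card S = k)"

definition anti_forcing_poly :: "'a set \<Rightarrow> 'a set set \<Rightarrow> int poly" where
  "anti_forcing_poly V E = (\<Sum>M\<in>perfect_matchings V E. monom 1 (af V E M))"

definition Af_H :: "nat \<Rightarrow> int poly" where
  "Af_H n = anti_forcing_poly (pyrene_V n) (pyrene_E n)"

end

theory Submission
  imports Defs
begin

text \<open>Perfect matchings of \<open>H\<^sub>n\<close> correspond to words of length \<open>n\<close> over six letters in which the
letter Rgt is never followed by Lft. The anti-forcing number is additive: it is the sum over the
letters of 1 for Lft and Rgt, 3 for the two symmetric and 2 for the two asymmetric middle letters.
The upper bound is an explicit set of edges; the lower bound exhibits that many perfect matchings
whose edges outside the given one are pairwise disjoint. Summing over the first letter gives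
the factor \<open>2x\<^sup>3 + 2x\<^sup>2 + 2x\<close>, and the words that begin with the forbidden factor Rgt Lft,
of weight 2, are subtracted.\<close>

section \<open>Coordinates on the pyrene system\<close>

text \<open>Edges and vertices are named by a fragment number (counted from 0) and a position in the
fragment; the Boolean is True in the upper half. With \<open>a = 4i\<close>, the zigzag through the abscissae
\<open>a - 1, \<dots>, a + 3\<close> consists of OuterL, InnerL, InnerR, OuterR; Rise and Cap are the remaining edges
of the outer hexagons. Central is the vertical edge at \<open>a + 1\<close>, and Join the one at \<open>a - 1\<close>, which
fragment \<open>i\<close> shares with fragment \<open>i - 1\<close>; hence the last fragment also has a Join numbered \<open>n\<close>.\<close>

datatype bond =
  OuterL bool | InnerL bool | InnerR bool | OuterR bool |
  RiseL bool | RiseR bool | CapL bool | CapR bool | Central | Join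

datatype site =
  S_join bool | S_left bool | S_mid bool | S_right bool |
  S_capL bool | S_apex bool | S_capR bool

definition sg :: "bool \<Rightarrow> int" where
  "sg b = (if b then 1 else -1)"

fun bond_edge :: "nat \<times> bond \<Rightarrow> edge" where
  "bond_edge (i, OuterL b) = {(4 * int i - 1, sg b), (4 * int i, 2 * sg b)}"
| "bond_edge (i, InnerL b) = {(4 * int i, 2 * sg b), (4 * int i + 1, sg b)}"
| "bond_edge (i, InnerR b) = {(4 * int i + 1, sg b), (4 * int i + 2, 2 * sg b)}"
| "bond_edge (i, OuterR b) = {(4 * int i + 2, 2 * sg b), (4 * int i + 3, sg b)}"
| "bond_edge (i, RiseL b) = {(4 * int i, 2 * sg b), (4 * int i, 4 * sg b)}"
| "bond_edge (i, RiseR b) = {(4 * int i + 2, 2 * sg b), (4 * int i + 2, 4 * sg b)}"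
| "bond_edge (i, CapL b) = {(4 * int i, 4 * sg b), (4 * int i + 1, 5 * sg b)}"
| "bond_edge (i, CapR b) = {(4 * int i + 1, 5 * sg b), (4 * int i + 2, 4 * sg b)}"
| "bond_edge (i, Central) = {(4 * int i + 1, 1), (4 * int i + 1, -1)}"
| "bond_edge (i, Join) = {(4 * int i - 1, 1), (4 * int i - 1, -1)}"

fun site_vertex :: "nat \<times> site \<Rightarrow> vertex" where
  "site_vertex (i, S_join b) = (4 * int i - 1, sg b)"
| "site_vertex (i, S_left b) = (4 * int i, 2 * sg b)"
| "site_vertex (i, S_mid b) = (4 * int i + 1, sg b)"
| "site_vertex (i, S_right b) = (4 * int i + 2, 2 * sg b)"
| "site_vertex (i, S_capL b) = (4 * int i, 4 * sg b)"
| "site_vertex (i, S_apex b) = (4 * int i + 1, 5 * sg b)"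
| "site_vertex (i, S_capR b) = (4 * int i + 2, 4 * sg b)"

fun bonds_at :: "nat \<times> site \<Rightarrow> (nat \<times> bond) set" where
  "bonds_at (i, S_join b) =
     {(i, Join), (i, OuterL b)} \<union> (if i = 0 then {} else {(i - 1, OuterR b)})"
| "bonds_at (i, S_left b) = {(i, OuterL b), (i, InnerL b), (i, RiseL b)}"
| "bonds_at (i, S_mid b) = {(i, InnerL b), (i, InnerR b), (i, Central)}"
| "bonds_at (i, S_right b) = {(i, InnerR b), (i, OuterR b), (i, RiseR b)}"
| "bonds_at (i, S_capL b) = {(i, RiseL b), (i, CapL b)}"
| "bonds_at (i, S_apex b) = {(i, CapL b), (i, CapR b)}"
| "bonds_at (i, S_capR b) = {(i, CapR b), (i, RiseR b)}"

lemma site_vertex_in_bond_edge_iff: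
  "site_vertex x \<in> bond_edge e \<longleftrightarrow> e \<in> bonds_at x"
proof -
  obtain i s where x: "x = (i, s)" by (cases x)
  obtain j k where e: "e = (j, k)" by (cases e)
  show ?thesis unfolding x e
    by (cases s; cases k) (auto simp: sg_def, presburger+)
qed

lemma bond_edge_eq_imp_eq:
  assumes "bond_edge e = bond_edge f"
  shows "e = f"
proof -
  \<comment> \<open>Distinct edges of the drawing have distinct midpoints.\<close>
  define mid :: "edge \<Rightarrow> vertex" where "mid d = (sum fst d, sum snd d)" for d
  obtain i k where e: "e = (i, k)" by (cases e)
  obtain j l where f: "f = (j, l)" by (cases f)
  have mid: "mid (bond_edge (i, k)) = (case k of
      OuterL b \<Rightarrow> (8 * int i - 1, 3 * sg b) | InnerL b \<Rightarrow> (8 * int i + 1, 3 * sg b)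
    | InnerR b \<Rightarrow> (8 * int i + 3, 3 * sg b) | OuterR b \<Rightarrow> (8 * int i + 5, 3 * sg b)
    | RiseL b \<Rightarrow> (8 * int i, 6 * sg b) | RiseR b \<Rightarrow> (8 * int i + 4, 6 * sg b)
    | CapL b \<Rightarrow> (8 * int i + 1, 9 * sg b) | CapR b \<Rightarrow> (8 * int i + 3, 9 * sg b)
    | Central \<Rightarrow> (8 * int i + 2, 0) | Join \<Rightarrow> (8 * int i - 2, 0))" for i k
    by (cases k) (simp_all add: mid_def sg_def)
  have "mid (bond_edge (i, k)) = mid (bond_edge (j, l))"
    using assms e f by simp
  then show ?thesis
    unfolding e f mid
    by (cases k; cases l) (auto simp: sg_def split: if_splits, presburger+)
qed

lemma inj_bond_edge: "inj bond_edge"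
  by (rule injI) (rule bond_edge_eq_imp_eq)

definition bonds :: "nat \<Rightarrow> (nat \<times> bond) set" where
  "bonds n = {(i, k). i < n \<or> i = n \<and> k = Join}"

definition sites :: "nat \<Rightarrow> (nat \<times> site) set" where
  "sites n = {(i, s). i < n \<or> i = n \<and> (\<exists>b. s = S_join b)}"

lemma pyrene_centres_eq:
  "pyrene_centres n =
     (\<Union>i<n. {(4 * int i, 0), (4 * int i + 2, 0), (4 * int i + 1, 3), (4 * int i + 1, -3)})"
  (is "?L = ?R")
proof
  show "?L \<subseteq> ?R"
  proof
    fix c assume "c \<in> ?L"
    then consider j where "c = (2 * j, 0)" "0 \<le> j" "j < 2 * int n"
      | i where "c = (4 * i - 3, 3) \<or> c = (4 * i - 3, -3)" "1 \<le> i" "i \<le> int n"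
      unfolding pyrene_centres_def by blast
    then show "c \<in> ?R"
    proof cases
      case 1
      have "nat (j div 2) < n" using 1 by linarith
      moreover have "c = (4 * int (nat (j div 2)), 0) \<or> c = (4 * int (nat (j div 2)) + 2, 0)"
        using 1 by (cases "even j") (auto elim!: evenE oddE)
      ultimately show ?thesis by blast
    next
      case 2
      have "nat (i - 1) < n" using 2 by linarith
      moreover have "c = (4 * int (nat (i - 1)) + 1, 3) \<or> c = (4 * int (nat (i - 1)) + 1, -3)"
        using 2 by auto
      ultimately show ?thesis by blast
    qed
  qed
  show "?R \<subseteq> ?L"
  proof
    fix c assume "c \<in> ?R"
    then obtain i where i: "i < n"
      "c \<in> {(4 * int i, 0), (4 * int i + 2, 0), (4 * int i + 1, 3), (4 * int i + 1, -3)}"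
      by blast
    have "\<exists>j. 4 * int i = 2 * j \<and> 0 \<le> j \<and> j < 2 * int n"
      "\<exists>j. 4 * int i + 2 = 2 * j \<and> 0 \<le> j \<and> j < 2 * int n"
      "\<exists>j. 4 * int i + 1 = 4 * j - 3 \<and> 1 \<le> j \<and> j \<le> int n"
      using i by presburger+
    with i show "c \<in> ?L" unfolding pyrene_centres_def by auto
  qed
qed

lemma UNIV_bond:
  "(UNIV :: bond set) = {OuterL True, OuterL False, InnerL True, InnerL False,
     InnerR True, InnerR False, OuterR True, OuterR False, RiseL True, RiseL False,
     RiseR True, RiseR False, CapL True, CapL False, CapR True, CapR False, Central, Join}"
proof -
  have "k \<in> {OuterL True, OuterL False, InnerL True, InnerL False,
     InnerR True, InnerR False, OuterR True, OuterR False, RiseL True, RiseL False,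
     RiseR True, RiseR False, CapL True, CapL False, CapR True, CapR False, Central, Join}" for k
    by (cases k) auto
  thus ?thesis by blast
qed

lemma fragment_edges:
  "(\<Union>c \<in> {(4 * int i, 0), (4 * int i + 2, 0), (4 * int i + 1, 3), (4 * int i + 1, -3)}. hex_edges c)
     = bond_edge ` ({i} \<times> UNIV \<union> {(Suc i, Join)})"
  (is "?L = _")
proof -
  have "bond_edge ` ({i} \<times> UNIV \<union> {(Suc i, Join)}) =
      insert (bond_edge (Suc i, Join)) ((\<lambda>k. bond_edge (i, k)) ` UNIV)"
    by auto
  also have "\<dots> = ?L"
    unfolding UNIV_bond
    by (simp add: hex_edges_def sg_def add.commute insert_commute)
  finally show ?thesis ..
qed

lemma bonds_eq:
  assumes "n > 0"
  shows "bonds n = (\<Union>i<n. {i} \<times> UNIV \<union> {(Suc i, Join)})"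
proof -
  have "(n, Join) \<in> (\<Union>i<n. {i} \<times> UNIV \<union> {(Suc i, Join)})"
    using assms by (intro UN_I[of "n - 1"]) auto
  thus ?thesis by (auto simp: bonds_def less_Suc_eq)
qed

lemma pyrene_E_eq:
  assumes "n > 0"
  shows "pyrene_E n = bond_edge ` bonds n"
proof -
  have "\<Union> (f ` (\<Union>i<n. C i)) = (\<Union>i<n. \<Union> (f ` C i))"
    for f :: "int \<times> int \<Rightarrow> edge set" and C :: "nat \<Rightarrow> (int \<times> int) set"
    by blast
  then show ?thesis
    unfolding pyrene_E_def pyrene_centres_eq bonds_eq[OF assms] image_UN[of bond_edge]
    by (simp only: fragment_edges)
qed

lemma pyrene_V_eq:
  assumes "n > 0"
  shows "pyrene_V n = site_vertex ` sites n"
proof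
  show "pyrene_V n \<subseteq> site_vertex ` sites n"
  proof
    fix v assume "v \<in> pyrene_V n"
    then obtain i k where ik: "(i, k) \<in> bonds n" "v \<in> bond_edge (i, k)"
      unfolding pyrene_V_def pyrene_E_eq[OF assms] by auto
    hence "\<exists>x \<in> sites n. v = site_vertex x" if "i < n"
    proof -
      have "v \<in> site_vertex ` ({i} \<times> UNIV \<union> {(Suc i, S_join True), (Suc i, S_join False)})"
        (is "v \<in> site_vertex ` ?B")
      proof -
        have "site_vertex (i, s) \<in> site_vertex ` ?B" "site_vertex (Suc i, S_join b) \<in> site_vertex ` ?B" for s b
          by (cases b; auto)+
        from this(1)[of "S_join True"] this(1)[of "S_join False"]
          this(1)[of "S_left True"] this(1)[of "S_left False"]
          this(1)[of "S_mid True"] this(1)[of "S_mid False"]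
          this(1)[of "S_right True"] this(1)[of "S_right False"]
          this(1)[of "S_capL True"] this(1)[of "S_capL False"]
          this(1)[of "S_apex True"] this(1)[of "S_apex False"]
          this(1)[of "S_capR True"] this(1)[of "S_capR False"] this(2)[of True] this(2)[of False] ik(2)
        show ?thesis by (cases k) (auto simp: sg_def split: if_splits)
      qed
      moreover have "?B \<subseteq> sites n"
        using that by (auto simp: sites_def)
      ultimately show ?thesis by blast
    qed
    moreover have "\<exists>x \<in> sites n. v = site_vertex x" if "\<not> i < n"
    proof -
      have "v = site_vertex (n, S_join True) \<or> v = site_vertex (n, S_join False)"
        using ik that by (auto simp: bonds_def sg_def)
      moreover have "(n, S_join b) \<in> sites n" for b
        by (simp add: sites_def)
      ultimately show ?thesis by blast
    qed
    ultimately show "v \<in> site_vertex ` sites n" by blast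
  qed
  show "site_vertex ` sites n \<subseteq> pyrene_V n"
  proof
    fix v assume "v \<in> site_vertex ` sites n"
    then obtain i s where v: "(i, s) \<in> sites n" "v = site_vertex (i, s)" by auto
    have "\<exists>e \<in> bonds n. e \<in> bonds_at (i, s)"
    proof
      let ?e = "(i, case s of S_join b \<Rightarrow> Join | S_left b \<Rightarrow> InnerL b | S_mid b \<Rightarrow> InnerL b
        | S_right b \<Rightarrow> InnerR b | S_capL b \<Rightarrow> CapL b | S_apex b \<Rightarrow> CapL b | S_capR b \<Rightarrow> CapR b)"
      show "?e \<in> bonds_at (i, s)" by (cases s) auto
      show "?e \<in> bonds n" using v(1) by (cases s) (auto simp: sites_def bonds_def)
    qed
    thus "v \<in> pyrene_V n"
      unfolding pyrene_V_def pyrene_E_eq[OF assms] v(2)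
      using site_vertex_in_bond_edge_iff by blast
  qed
qed

definition perfect_bonds :: "nat \<Rightarrow> (nat \<times> bond) set \<Rightarrow> bool" where
  "perfect_bonds n m \<longleftrightarrow> m \<subseteq> bonds n \<and> (\<forall>x \<in> sites n. \<exists>!e. e \<in> m \<and> e \<in> bonds_at x)"

lemma perfect_matching_bonds_iff:
  assumes "n > 0"
  shows "perfect_matching (pyrene_V n) (pyrene_E n) (bond_edge ` m) \<longleftrightarrow> perfect_bonds n m"
proof -
  have "(\<exists>!f. f \<in> bond_edge ` m \<and> site_vertex x \<in> f) \<longleftrightarrow> (\<exists>!e. e \<in> m \<and> e \<in> bonds_at x)" for x
    unfolding site_vertex_in_bond_edge_iff[symmetric]
    by (auto simp: Ex1_def dest: bond_edge_eq_imp_eq)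
  moreover have "bond_edge ` m \<subseteq> bond_edge ` bonds n \<longleftrightarrow> m \<subseteq> bonds n"
    by (rule inj_image_subset_iff[OF inj_bond_edge])
  ultimately show ?thesis
    unfolding perfect_matching_def perfect_bonds_def pyrene_V_eq[OF assms] pyrene_E_eq[OF assms]
    by simp
qed

section \<open>Perfect matchings as words\<close>

text \<open>Each zigzag half of a fragment covers, from the fragment itself, exactly one of its three
vertices at odd abscissae next to the axis, and both halves cover the same one. If it is the left or the
right one (Lft, Rgt) the matching of the fragment is determined; if it is the middle one (Mid) there
remain two choices in each half, True standing for InnerL.\<close>

datatype frag = Lft | Rgt | Mid bool bool

fun is_mid :: "frag \<Rightarrow> bool" where
  "is_mid (Mid x y) = True"
| "is_mid _ = False"

fun leftward :: "frag \<Rightarrow> bool \<Rightarrow> bool" where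
  "leftward Lft b = True"
| "leftward Rgt b = False"
| "leftward (Mid x y) b = (if b then x else y)"

fun uses :: "frag \<Rightarrow> bond \<Rightarrow> bool" where
  "uses c (OuterL b) = (c = Lft)"
| "uses c (InnerL b) = (is_mid c \<and> leftward c b)"
| "uses c (InnerR b) = (is_mid c \<and> \<not> leftward c b)"
| "uses c (OuterR b) = (c = Rgt)"
| "uses c (RiseL b) = (\<not> leftward c b)"
| "uses c (RiseR b) = leftward c b"
| "uses c (CapL b) = leftward c b"
| "uses c (CapR b) = (\<not> leftward c b)"
| "uses c Central = (\<not> is_mid c)"
| "uses c Join = False"

definition admissible :: "frag list \<Rightarrow> bool" where
  "admissible = successively (\<lambda>c d. \<not> (c = Rgt \<and> d = Lft))"

definition words :: "nat \<Rightarrow> frag list set" where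
  "words n = {w. length w = n \<and> admissible w}"

definition open_join :: "frag list \<Rightarrow> nat \<Rightarrow> bool" where
  "open_join w i \<longleftrightarrow> i < length w \<and> w ! i = Lft \<or> 0 < i \<and> w ! (i - 1) = Rgt"

definition word_bonds :: "frag list \<Rightarrow> (nat \<times> bond) set" where
  "word_bonds w = {(i, k). i < length w \<and> uses (w ! i) k}
     \<union> {(i, Join) | i. i \<le> length w \<and> \<not> open_join w i}"

lemma word_bonds_iff:
  "(i, k) \<in> word_bonds w \<longleftrightarrow>
     (if k = Join then i \<le> length w \<and> \<not> open_join w i else i < length w \<and> uses (w ! i) k)"
  by (auto simp: word_bonds_def)

lemma admissible_iff:
  "admissible w \<longleftrightarrow> (\<forall>i. Suc i < length w \<longrightarrow> \<not> (w ! i = Rgt \<and> w ! Suc i = Lft))"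
  unfolding admissible_def successively_conv_nth by simp

lemma ex1_two_iff:
  "a \<noteq> b \<Longrightarrow> (\<exists>!e. e \<in> m \<and> e \<in> {a, b}) \<longleftrightarrow> (a \<in> m \<longleftrightarrow> b \<notin> m)"
  by (auto simp: Ex1_def)

lemma ex1_three_iff:
  "a \<noteq> b \<Longrightarrow> a \<noteq> c \<Longrightarrow> b \<noteq> c \<Longrightarrow> (\<exists>!e. e \<in> m \<and> e \<in> {a, b, c}) \<longleftrightarrow>
    (a \<in> m \<and> b \<notin> m \<and> c \<notin> m \<or> a \<notin> m \<and> b \<in> m \<and> c \<notin> m \<or> a \<notin> m \<and> b \<notin> m \<and> c \<in> m)"
  by (auto simp: Ex1_def)

lemma perfect_bonds_word_bonds:
  assumes "w \<in> words n"
  shows "perfect_bonds n (word_bonds w)"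
  unfolding perfect_bonds_def
proof (intro conjI ballI)
  have n: "length w = n" and adm: "admissible w"
    using assms by (auto simp: words_def)
  show "word_bonds w \<subseteq> bonds n"
    by (auto simp: word_bonds_iff bonds_def n split: if_splits)
  fix x assume "x \<in> sites n"
  moreover obtain i s where x: "x = (i, s)" by (cases x)
  ultimately have is_site: "(i, s) \<in> sites n" by simp
  show "\<exists>!e. e \<in> word_bonds w \<and> e \<in> bonds_at x"
  proof (cases "\<exists>b. s = S_join b")
    case True
    then obtain b where s: "s = S_join b" by blast
    show ?thesis
    proof (cases i)
      case 0
      have "open_join w 0 \<longleftrightarrow> 0 < length w \<and> w ! 0 = Lft"
        by (simp add: open_join_def)
      moreover have "bonds_at (0, S_join b) = {(0, Join), (0, OuterL b)}"
        by simp
      ultimately show ?thesis unfolding x s 0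
        by (simp only: ex1_two_iff prod.inject bond.distinct simp_thms) (auto simp: word_bonds_iff)
    next
      case (Suc j)
      have "j < n" using is_site Suc s by (auto simp: sites_def)
      moreover have "\<not> (Suc j < n \<and> w ! j = Rgt \<and> w ! Suc j = Lft)"
        using adm n by (auto simp: admissible_iff)
      moreover have "open_join w (Suc j) \<longleftrightarrow> Suc j < length w \<and> w ! Suc j = Lft \<or> w ! j = Rgt"
        by (simp add: open_join_def)
      moreover have "bonds_at (Suc j, S_join b) = {(Suc j, Join), (Suc j, OuterL b), (j, OuterR b)}"
        by auto
      ultimately show ?thesis unfolding x s Suc
        by (simp only: ex1_three_iff prod.inject bond.distinct simp_thms)
          (auto simp: word_bonds_iff n)
    qed
  next
    case False
    hence "i < n" using is_site by (auto simp: sites_def)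
    thus ?thesis unfolding x
      using False
      by (cases s; simp only: bonds_at.simps ex1_two_iff ex1_three_iff prod.inject bond.distinct simp_thms;
        cases "w ! i"; simp add: word_bonds_iff n)
  qed
qed

text \<open>The agreement of the two halves propagates from left to right through the Join edges.\<close>

lemma perfect_bonds_is_word_bonds:
  assumes "perfect_bonds n m"
  shows "\<exists>w \<in> words n. word_bonds w = m"
proof -
  have sub: "m \<subseteq> bonds n" and ex: "\<And>x. x \<in> sites n \<Longrightarrow> \<exists>!e. e \<in> m \<and> e \<in> bonds_at x"
    using assms by (auto simp: perfect_bonds_def)
  have site: "(i, s) \<in> sites n" if "i < n" for i s
    using that by (simp add: sites_def)
  have capL: "(i, RiseL b) \<in> m \<longleftrightarrow> (i, CapL b) \<notin> m"
    and apex: "(i, CapL b) \<in> m \<longleftrightarrow> (i, CapR b) \<notin> m"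
    and capR: "(i, CapR b) \<in> m \<longleftrightarrow> (i, RiseR b) \<notin> m" if "i < n" for i b
    using ex[OF site[OF that, of "S_capL b"]] ex[OF site[OF that, of "S_apex b"]]
      ex[OF site[OF that, of "S_capR b"]]
    by (simp_all only: bonds_at.simps ex1_two_iff prod.inject bond.distinct simp_thms)
  note left = ex[OF site, of _ "S_left b" for b,
      simplified bonds_at.simps ex1_three_iff prod.inject bond.distinct simp_thms]
  note mid = ex[OF site, of _ "S_mid b" for b,
      simplified bonds_at.simps ex1_three_iff prod.inject bond.distinct simp_thms]
  note right = ex[OF site, of _ "S_right b" for b,
      simplified bonds_at.simps ex1_three_iff prod.inject bond.distinct simp_thms]
  have join0: "(0, Join) \<in> m \<longleftrightarrow> (0, OuterL b) \<notin> m" for b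
  proof -
    have "(0, S_join b) \<in> sites n" by (auto simp: sites_def)
    from ex[OF this] show ?thesis by (simp add: ex1_two_iff[simplified])
  qed
  have joinS: "(Suc i, Join) \<in> m \<and> (Suc i, OuterL b) \<notin> m \<and> (i, OuterR b) \<notin> m
      \<or> (Suc i, Join) \<notin> m \<and> (Suc i, OuterL b) \<in> m \<and> (i, OuterR b) \<notin> m
      \<or> (Suc i, Join) \<notin> m \<and> (Suc i, OuterL b) \<notin> m \<and> (i, OuterR b) \<in> m" if "i < n" for i b
  proof -
    have "(Suc i, S_join b) \<in> sites n" using that by (auto simp: sites_def)
    from ex[OF this] show ?thesis
      by (simp add: ex1_three_iff[simplified] insert_commute[of "(i, OuterR b)"])
  qed
  have sym: "((i, OuterL True) \<in> m \<longleftrightarrow> (i, OuterL False) \<in> m) \<and>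
      ((i, OuterR True) \<in> m \<longleftrightarrow> (i, OuterR False) \<in> m)" if "i < n" for i
    using that
  proof (induction i)
    case 0
    show ?case
      using 0 join0[of True] join0[of False] capL[of 0 True] capL[of 0 False]
        apex[of 0 True] apex[of 0 False] capR[of 0 True] capR[of 0 False]
        left[of 0 True] left[of 0 False] mid[of 0 True] mid[of 0 False]
        right[of 0 True] right[of 0 False]
      by argo
  next
    case (Suc i)
    show ?case
      using Suc joinS[of i True] joinS[of i False]
        capL[of "Suc i" True] capL[of "Suc i" False]
        apex[of "Suc i" True] apex[of "Suc i" False] capR[of "Suc i" True] capR[of "Suc i" False]
        left[of "Suc i" True] left[of "Suc i" False] mid[of "Suc i" True] mid[of "Suc i" False]
        right[of "Suc i" True] right[of "Suc i" False] Suc_lessD[OF Suc.prems]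
      by argo
  qed
  define c where "c i = (if (i, OuterL True) \<in> m then Lft else if (i, OuterR True) \<in> m then Rgt
      else Mid ((i, CapL True) \<in> m) ((i, CapL False) \<in> m))" for i
  define w where "w = map c [0..<n]"
  have len: "length w = n" and nth: "\<And>i. i < n \<Longrightarrow> w ! i = c i"
    by (simp_all add: w_def)
  have c_Lft: "c i = Lft \<longleftrightarrow> (i, OuterL b) \<in> m" and c_Rgt: "c i = Rgt \<longleftrightarrow> (i, OuterR b) \<in> m"
    if "i < n" for i b
    using sym[OF that] left[OF that, of True] right[OF that, of True] capL[OF that, of True]
      apex[OF that, of True] capR[OF that, of True]
    by (cases b; auto simp: c_def)+
  have uses: "uses (c i) k \<longleftrightarrow> (i, k) \<in> m" if "i < n" "k \<noteq> Join" for i k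
    using sym[OF that(1)] left[OF that(1), of True] right[OF that(1), of True] capL[OF that(1), of True]
      apex[OF that(1), of True] capR[OF that(1), of True] mid[OF that(1), of True]
      left[OF that(1), of False] right[OF that(1), of False] capL[OF that(1), of False]
      apex[OF that(1), of False] capR[OF that(1), of False] mid[OF that(1), of False] that(2)
      UNIV_I[of k] unfolding UNIV_bond
    by (elim insertE emptyE; simp add: c_def; argo)
  have join: "(i, Join) \<in> m \<longleftrightarrow> \<not> open_join w i" if "i \<le> n" for i
  proof (cases i)
    case 0
    have "(0, OuterL True) \<notin> m" if "n = 0"
      using sub that by (auto simp: bonds_def)
    thus ?thesis using 0 join0[of True] c_Lft[of 0 True]
      by (cases "n = 0") (auto simp: open_join_def len nth)
  next
    case (Suc j)
    have "(Suc j, OuterL True) \<notin> m" if "Suc j \<ge> n"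
      using sub that by (auto simp: bonds_def)
    thus ?thesis
      using Suc that joinS[of j True] c_Lft[of "Suc j" True] c_Rgt[of j True]
      by (cases "Suc j < n") (auto simp: open_join_def len nth)
  qed
  have "admissible w"
    unfolding admissible_iff len
    using joinS[of _ True] c_Lft[of _ True] c_Rgt[of _ True] nth by (metis Suc_lessD)
  moreover have "word_bonds w = m"
  proof (rule set_eqI)
    fix e :: "nat \<times> bond"
    obtain i k where e: "e = (i, k)" by (cases e)
    show "e \<in> word_bonds w \<longleftrightarrow> e \<in> m"
      using sub uses[of i k] join[of i]
      by (auto simp: e word_bonds_iff len nth bonds_def)
  qed
  ultimately show ?thesis
    using len by (auto simp: words_def)
qed

lemma word_bonds_eq_imp_eq:
  assumes "length v = length w" "word_bonds v = word_bonds w"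
  shows "v = w"
proof (rule nth_equalityI)
  show "length v = length w" by fact
  fix i assume i: "i < length v"
  have "uses (v ! i) k \<longleftrightarrow> uses (w ! i) k" for k
    using assms i word_bonds_iff[of i k v] word_bonds_iff[of i k w]
    by (cases "k = Join") auto
  from this[of "OuterL True"] this[of "OuterR True"] this[of "CapL True"] this[of "CapL False"]
  show "v ! i = w ! i" by (cases "v ! i"; cases "w ! i") auto
qed

lemma perfect_matchings_pyrene:
  assumes "n > 0"
  shows "perfect_matchings (pyrene_V n) (pyrene_E n) = (\<lambda>w. bond_edge ` word_bonds w) ` words n"
proof (intro set_eqI iffI)
  fix M assume "M \<in> perfect_matchings (pyrene_V n) (pyrene_E n)"
  hence M: "perfect_matching (pyrene_V n) (pyrene_E n) M"
    by (simp add: perfect_matchings_def)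
  hence "M \<subseteq> bond_edge ` bonds n"
    by (simp add: perfect_matching_def pyrene_E_eq[OF assms])
  then obtain m where m: "M = bond_edge ` m"
    by (auto simp: subset_image_iff)
  with M have "perfect_bonds n m"
    by (simp add: perfect_matching_bonds_iff[OF assms])
  with m show "M \<in> (\<lambda>w. bond_edge ` word_bonds w) ` words n"
    using perfect_bonds_is_word_bonds by blast
qed (auto simp: perfect_matchings_def perfect_matching_bonds_iff[OF assms] perfect_bonds_word_bonds)

lemma inj_on_word_matching: "inj_on (\<lambda>w. bond_edge ` word_bonds w) (words n)"
  by (rule inj_onI)
    (auto simp: words_def inj_image_eq_iff[OF inj_bond_edge] intro: word_bonds_eq_imp_eq)

section \<open>The anti-forcing number of a word\<close>

fun weight :: "frag \<Rightarrow> nat" where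
  "weight Lft = 1"
| "weight Rgt = 1"
| "weight (Mid x y) = (if x = y then 3 else 2)"

definition word_weight :: "frag list \<Rightarrow> nat" where
  "word_weight w = sum_list (map weight w)"

lemma word_weight_simps [simp]:
  "word_weight [] = 0" "word_weight (c # w) = weight c + word_weight w"
  by (simp_all add: word_weight_def)

lemma word_weight_conv_sum: "word_weight w = (\<Sum>i<length w. weight (w ! i))"
  by (simp add: word_weight_def sum_list_sum_nth atLeast0LessThan)

definition cut_at :: "frag list \<Rightarrow> nat \<Rightarrow> (nat \<times> bond) set" where
  "cut_at w i = (case w ! i of
     Lft \<Rightarrow> {(i, Join)}
   | Rgt \<Rightarrow> {(Suc i, Join)}
   | Mid x y \<Rightarrow> {(i, if x then CapR True else CapL True), (i, if y then CapR False else CapL False)}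
       \<union> (if x = y then {(i, if x then OuterL True else OuterR True)} else {}))"

definition word_cut :: "frag list \<Rightarrow> (nat \<times> bond) set" where
  "word_cut w = (\<Union>i<length w. cut_at w i)"

lemma card_cut_le: "card (word_cut w) \<le> word_weight w"
proof -
  have "card (cut_at w i) \<le> weight (w ! i)" for i
    by (cases "w ! i") (simp_all add: cut_at_def card_insert_if)
  hence "(\<Sum>i<length w. card (cut_at w i)) \<le> word_weight w"
    unfolding word_weight_conv_sum by (intro sum_mono)
  with card_UN_le[of "{..<length w}" "cut_at w"] show ?thesis
    unfolding word_cut_def by simp
qed

lemma cut_subset:
  assumes "w \<in> words n"
  shows "word_cut w \<subseteq> bonds n - word_bonds w"
proof
  fix e assume "e \<in> word_cut w"
  then obtain i where i: "i < length w" "e \<in> cut_at w i"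
    by (auto simp: word_cut_def)
  have "length w = n" using assms by (simp add: words_def)
  with i show "e \<in> bonds n - word_bonds w"
    by (cases "w ! i")
      (auto simp: cut_at_def bonds_def word_bonds_iff open_join_def split: if_splits)
qed

lemma word_avoiding_cut_unique:
  assumes v: "v \<in> words n" and w: "w \<in> words n" and avoid: "word_bonds v \<inter> word_cut w = {}"
  shows "v = w"
proof -
  have len: "length v = n" "length w = n" and adm: "admissible v" "admissible w"
    using v w by (auto simp: words_def)
  have out: "e \<notin> word_bonds v" if "i < n" "e \<in> cut_at w i" for i e
    using avoid that len by (auto simp: word_cut_def)
  have mid: "v ! i = w ! i" if i: "i < n" "is_mid (w ! i)" for i
  proof -
    obtain x y where wi: "w ! i = Mid x y" using i(2) by (cases "w ! i") auto
    have "\<not> uses (v ! i) k" if "(i, k) \<in> cut_at w i" "k \<noteq> Join" for k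
      using out[OF i(1) that(1)] that(2) i(1) by (simp add: word_bonds_iff len)
    moreover have "(i, if x then CapR True else CapL True) \<in> cut_at w i"
      "(i, if y then CapR False else CapL False) \<in> cut_at w i"
      "x = y \<Longrightarrow> (i, if x then OuterL True else OuterR True) \<in> cut_at w i"
      by (simp_all add: cut_at_def wi)
    ultimately have "\<not> uses (v ! i) (if x then CapR True else CapL True)"
      "\<not> uses (v ! i) (if y then CapR False else CapL False)"
      "x = y \<Longrightarrow> \<not> uses (v ! i) (if x then OuterL True else OuterR True)"
      by simp_all
    thus ?thesis unfolding wi by (cases "v ! i") (auto split: if_splits)
  qed
  have left: "v ! i = Lft" if "i < n" "w ! i = Lft" for i
    using that
  proof (induction i)
    case 0
    have "(0, Join) \<notin> word_bonds v" using out[of 0] 0 by (simp add: cut_at_def)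
    thus ?case by (auto simp: word_bonds_iff open_join_def)
  next
    case (Suc i)
    have "(Suc i, Join) \<notin> word_bonds v" using out[of "Suc i"] Suc.prems by (simp add: cut_at_def)
    hence "v ! Suc i = Lft \<or> v ! i = Rgt"
      using Suc.prems by (auto simp: word_bonds_iff open_join_def len)
    moreover have "v ! i \<noteq> Rgt"
    proof
      assume R: "v ! i = Rgt"
      have "w ! i \<noteq> Rgt" using adm(2) Suc.prems len by (auto simp: admissible_iff)
      with R mid[of i] Suc show False by (cases "w ! i") auto
    qed
    ultimately show ?case by blast
  qed
  have right: "v ! i = Rgt" if "i < n" "w ! i = Rgt" for i
    using that
  proof (induction "n - i" arbitrary: i rule: less_induct)
    case less
    have "(Suc i, Join) \<notin> word_bonds v" using out[of i] less.prems by (simp add: cut_at_def)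
    hence "v ! i = Rgt \<or> Suc i < n \<and> v ! Suc i = Lft"
      using less.prems by (auto simp: word_bonds_iff open_join_def len)
    moreover have "\<not> (Suc i < n \<and> v ! Suc i = Lft)"
    proof
      assume L: "Suc i < n \<and> v ! Suc i = Lft"
      hence "w ! Suc i \<noteq> Lft" using adm(2) less.prems len by (auto simp: admissible_iff)
      moreover have "n - Suc i < n - i" using L by linarith
      ultimately show False
        using L mid[of "Suc i"] less.hyps[of "Suc i"] by (cases "w ! Suc i") auto
    qed
    ultimately show ?case by blast
  qed
  show ?thesis
  proof (rule nth_equalityI)
    fix i assume "i < length v"
    thus "v ! i = w ! i"
      using mid[of i] left[of i] right[of i] len by (cases "w ! i") auto
  qed (simp add: len)
qed

text \<open>For the lower bound, the edges outside a matching are coloured with pairs \<open>(i, j)\<close>,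
\<open>j < weight (w ! i)\<close>, so that every colour class contains the new edges of some other perfect
matching; an anti-forcing set then meets every colour.\<close>

fun layer :: "bond \<Rightarrow> nat" where
  "layer (InnerL b) = of_bool (\<not> b)"
| "layer (InnerR b) = of_bool (\<not> b)"
| "layer (RiseL b) = of_bool (\<not> b)"
| "layer (RiseR b) = of_bool (\<not> b)"
| "layer (CapL b) = of_bool (\<not> b)"
| "layer (CapR b) = of_bool (\<not> b)"
| "layer _ = 2"

fun colour :: "frag list \<Rightarrow> nat \<times> bond \<Rightarrow> nat \<times> nat" where
  "colour w (p, k) =
     (if k = Join then (if p < length w \<and> w ! p = Lft then (p, 0) else (p - 1, 0))
      else (case w ! p of
        Lft \<Rightarrow> if uses (Mid False False) k then (p - 1, 2) else (p, 0)
      | Rgt \<Rightarrow> if uses (Mid True True) k then (Suc p, 2) else (p, 0)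
      | Mid x y \<Rightarrow> (p, layer k)))"

lemma new_bond_cases [consumes 2]:
  assumes "(p, k) \<in> word_bonds v - word_bonds w" "length v = length w"
  obtains "k = Join" "p \<le> length w" "open_join w p" "\<not> open_join v p"
  | "k \<noteq> Join" "p < length w" "uses (v ! p) k" "\<not> uses (w ! p) k"
  using assms by (auto simp: word_bonds_iff split: if_splits)

lemma monochromatic_change:
  assumes w: "w \<in> words n" and i: "i < n" and j: "j < weight (w ! i)"
  shows "\<exists>v \<in> words n. v \<noteq> w \<and> (\<forall>e \<in> word_bonds v - word_bonds w. colour w e = (i, j))"
proof -
  have len: "length w = n" and adm: "\<And>p. Suc p < n \<Longrightarrow> w ! p = Rgt \<Longrightarrow> w ! Suc p \<noteq> Lft"
    using w by (auto simp: words_def admissible_iff)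
  \<comment> \<open>Usually changing one letter gives the other matching.\<close>
  have single: ?thesis
    if "c \<noteq> w ! i"
      and "c = Lft \<Longrightarrow> i = 0 \<or> w ! (i - 1) \<noteq> Rgt"
      and "c = Rgt \<Longrightarrow> Suc i < n \<Longrightarrow> w ! Suc i \<noteq> Lft"
      and "\<And>k. uses c k \<Longrightarrow> \<not> uses (w ! i) k \<Longrightarrow> colour w (i, k) = (i, j)"
      and "w ! i = Lft \<or> w ! i = Rgt \<Longrightarrow> j = 0" for c
  proof (intro bexI conjI ballI)
    let ?v = "w[i := c]"
    show "?v \<noteq> w" using that(1) i len by (metis nth_list_update_eq)
    show "?v \<in> words n"
      using adm len i that(2,3) by (auto simp: words_def admissible_iff nth_list_update)
    fix e assume e: "e \<in> word_bonds ?v - word_bonds w"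
    obtain p k where pk: "e = (p, k)" by (cases e)
    have "(p, k) \<in> word_bonds ?v - word_bonds w" "length ?v = length w"
      using e by (simp_all add: pk)
    then show "colour w e = (i, j)"
    proof (cases rule: new_bond_cases)
      case 1
      hence "p = i \<and> w ! i = Lft \<or> p = Suc i \<and> w ! i = Rgt"
        using i len by (auto simp: open_join_def nth_list_update split: if_splits)
      thus ?thesis using that(5) 1 i len adm[of i] by (auto simp: pk)
    next
      case 2
      hence "p = i" by (metis nth_list_update_neq)
      with 2 that(4)[of k] i len show ?thesis by (simp add: pk)
    qed
  qed
  \<comment> \<open>If that would create the forbidden factor, the neighbouring letter moves to the far side of
    its fragment, where its new edges are disjoint from those of its own colour.\<close>
  have double: ?thesis
    if l: "Suc l < n" and change:
        "w ! l = Rgt \<and> w ! Suc l = Mid True True \<and> i = Suc l \<and> c = Mid True True \<and> d = Lft \<or>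
         w ! l = Mid False False \<and> w ! Suc l = Lft \<and> i = l \<and> c = Rgt \<and> d = Mid False False"
      and j: "j = 2" for l c d
  proof (intro bexI conjI ballI)
    let ?v = "w[l := c, Suc l := d]"
    have v: "?v ! l = c" "?v ! Suc l = d" "\<And>p. p \<noteq> l \<Longrightarrow> p \<noteq> Suc l \<Longrightarrow> ?v ! p = w ! p"
      using l len by simp_all
    have lenv: "length ?v = length w" by simp
    show "?v \<noteq> w"
    proof
      assume "?v = w"
      hence "w ! l = c" using v(1) by (simp only:)
      with change show False by auto
    qed
    have "\<not> (?v ! p = Rgt \<and> ?v ! Suc p = Lft)" if "Suc p < n" for p
    proof -
      consider "p = l" | "p = Suc l" | "Suc p = l" | "p \<noteq> l" "p \<noteq> Suc l" "Suc p \<noteq> l" by blast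
      thus ?thesis
        using v(1,2) v(3)[of p] v(3)[of "Suc p"] adm[OF that] change by cases auto
    qed
    thus "?v \<in> words n"
      unfolding words_def admissible_iff mem_Collect_eq lenv len by blast
    fix e assume e: "e \<in> word_bonds ?v - word_bonds w"
    obtain p k where pk: "e = (p, k)" by (cases e)
    have "(p, k) \<in> word_bonds ?v - word_bonds w" using e by (simp only: pk)
    from this lenv show "colour w e = (i, j)"
    proof (cases rule: new_bond_cases)
      case 1
      consider "p = l" | "p = Suc l" | "p = Suc (Suc l)" | "p \<noteq> l" "p \<noteq> Suc l" "p - 1 \<noteq> l" "p - 1 \<noteq> Suc l"
        by linarith
      hence "open_join w p \<Longrightarrow> open_join ?v p"
        unfolding open_join_def lenv
        using v(1,2) v(3)[of p] v(3)[of "p - 1"] change l len by cases auto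
      with 1 show ?thesis by blast
    next
      case 2
      hence "p = l \<or> p = Suc l" using v(3)[of p] by (metis (no_types))
      thus ?thesis
      proof
        assume p: "p = l"
        hence "uses c k" using 2(3) v(1) by (simp only:)
        with 2 change j p show ?thesis unfolding pk by (cases k) auto
      next
        assume p: "p = Suc l"
        hence "uses d k" using 2(3) v(2) by (simp only:)
        with 2 change j p show ?thesis unfolding pk by (cases k) auto
      qed
    qed
  qed
  show ?thesis
  proof (cases "w ! i")
    case Lft
    have "colour w (i, k) = (i, j)" if "uses (Mid True True) k" "\<not> uses (w ! i) k" for k
      using that Lft j by (cases k) auto
    thus ?thesis using single[of "Mid True True"] Lft j by auto
  next
    case Rgt
    have "colour w (i, k) = (i, j)" if "uses (Mid False False) k" "\<not> uses (w ! i) k" for k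
      using that Rgt j by (cases k) auto
    thus ?thesis using single[of "Mid False False"] Rgt j by auto
  next
    case (Mid x y)
    consider "j = 0" | "j = 1" | "j = 2" "x = y" "x" | "j = 2" "x = y" "\<not> x"
      using j Mid by (auto split: if_splits) linarith+
    thus ?thesis
    proof cases
      case 1
      have "colour w (i, k) = (i, j)" if "uses (Mid (\<not> x) y) k" "\<not> uses (w ! i) k" for k
        using that Mid 1 by (cases k) (auto split: if_splits)
      thus ?thesis using single[of "Mid (\<not> x) y"] Mid by auto
    next
      case 2
      have "colour w (i, k) = (i, j)" if "uses (Mid x (\<not> y)) k" "\<not> uses (w ! i) k" for k
        using that Mid 2 by (cases k) (auto split: if_splits)
      thus ?thesis using single[of "Mid x (\<not> y)"] Mid by auto
    next
      case 3
      show ?thesis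
      proof (cases "i = 0 \<or> w ! (i - 1) \<noteq> Rgt")
        case True
        have "colour w (i, k) = (i, j)" if "uses Lft k" "\<not> uses (w ! i) k" for k
          using that Mid 3 by (cases k) (auto split: if_splits)
        thus ?thesis using single[of Lft] Mid True by auto
      next
        case False
        thus ?thesis using double[of "i - 1" "Mid True True" Lft] Mid 3 i by auto
      qed
    next
      case 4
      show ?thesis
      proof (cases "Suc i < n \<longrightarrow> w ! Suc i \<noteq> Lft")
        case True
        have "colour w (i, k) = (i, j)" if "uses Rgt k" "\<not> uses (w ! i) k" for k
          using that Mid 4 by (cases k) (auto split: if_splits)
        thus ?thesis using single[of Rgt] Mid True by auto
      next
        case False
        thus ?thesis using double[of i Rgt "Mid False False"] Mid 4 i by auto
      qed
    qed
  qed
qed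

lemma perfect_matchings_delete:
  "perfect_matchings V (E - S) = {N \<in> perfect_matchings V E. N \<inter> S = {}}"
  by (auto simp: perfect_matchings_def perfect_matching_def)

lemma card_le_anti_forcing_set:
  assumes S: "anti_forcing_set V E M S" "finite S"
    and J: "\<And>j. j \<in> J \<Longrightarrow> \<exists>N \<in> perfect_matchings V E. N \<noteq> M \<and> (\<forall>e \<in> N - M. col e = j)"
  shows "card J \<le> card S"
proof -
  have "J \<subseteq> col ` S"
  proof
    fix j assume "j \<in> J"
    then obtain N where N: "N \<in> perfect_matchings V E" "N \<noteq> M" "\<And>e. e \<in> N - M \<Longrightarrow> col e = j"
      using J by meson
    have "N \<inter> S \<noteq> {}"
      using S(1) N(1,2) unfolding anti_forcing_set_def perfect_matchings_delete by blast
    then obtain e where "e \<in> N" "e \<in> S" by blast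
    moreover from this have "e \<notin> M" using S(1) by (auto simp: anti_forcing_set_def)
    ultimately show "j \<in> col ` S" using N(3) by blast
  qed
  thus ?thesis
    using card_mono[of "col ` S" J] card_image_le[of S col] S(2) by simp
qed

lemma af_word:
  assumes n: "n > 0" and w: "w \<in> words n"
  shows "af (pyrene_V n) (pyrene_E n) (bond_edge ` word_bonds w) = word_weight w"
proof -
  let ?V = "pyrene_V n" and ?E = "pyrene_E n" and ?M = "bond_edge ` word_bonds w"
  note pm = perfect_matchings_pyrene[OF n]
  have len: "length w = n" using w by (simp add: words_def)
  have "finite (UNIV :: bond set)" unfolding UNIV_bond by simp
  hence "finite (bonds n)"
    by (intro finite_subset[of "bonds n" "{..n} \<times> UNIV"]) (auto simp: bonds_def)
  hence fin: "finite ?E" by (simp add: pyrene_E_eq[OF n])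
  have lower: "word_weight w \<le> card S" if S: "anti_forcing_set ?V ?E ?M S" for S
  proof -
    have "finite S"
      using S fin by (auto simp: anti_forcing_set_def intro: finite_subset)
    moreover have "\<exists>N \<in> perfect_matchings ?V ?E. N \<noteq> ?M \<and>
        (\<forall>e \<in> N - ?M. (colour w \<circ> inv bond_edge) e = x)"
      if mem: "x \<in> (SIGMA i:{..<n}. {..<weight (w ! i)})" for x
    proof -
      obtain i j where x: "x = (i, j)" "i < n" "j < weight (w ! i)" using mem by auto
      from monochromatic_change[OF w x(2,3)] obtain v where v: "v \<in> words n" "v \<noteq> w"
        "\<forall>e \<in> word_bonds v - word_bonds w. colour w e = (i, j)" by blast
      let ?N = "bond_edge ` word_bonds v"
      have "?N \<noteq> ?M"
        using inj_onD[OF inj_on_word_matching _ v(1) w] v(2) by blast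
      moreover have "?N - ?M = bond_edge ` (word_bonds v - word_bonds w)"
        by (simp add: image_set_diff[OF inj_bond_edge])
      ultimately show ?thesis
        using v by (intro bexI[of _ ?N]) (auto simp: pm x(1) inv_f_f[OF inj_bond_edge])
    qed
    ultimately have "card (SIGMA i:{..<n}. {..<weight (w ! i)}) \<le> card S"
      by (rule card_le_anti_forcing_set[OF S])
    thus ?thesis by (simp add: word_weight_conv_sum len)
  qed
  have anti: "anti_forcing_set ?V ?E ?M (bond_edge ` word_cut w)"
    unfolding anti_forcing_set_def
  proof
    show "bond_edge ` word_cut w \<subseteq> ?E - ?M"
      unfolding pyrene_E_eq[OF n] image_set_diff[OF inj_bond_edge, symmetric]
      using cut_subset[OF w] by blast
    have "bond_edge ` word_bonds v \<inter> bond_edge ` word_cut w = {} \<longleftrightarrow> v = w" if "v \<in> words n" for v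
      using word_avoiding_cut_unique[OF that w] cut_subset[OF w]
      unfolding image_Int[OF inj_bond_edge, symmetric] by auto
    with w show "perfect_matchings ?V (?E - bond_edge ` word_cut w) = {?M}"
      unfolding perfect_matchings_delete pm by blast
  qed
  have "card (bond_edge ` word_cut w) = card (word_cut w)"
    by (rule card_image) (rule inj_on_subset[OF inj_bond_edge subset_UNIV])
  hence "card (bond_edge ` word_cut w) = word_weight w"
    using lower[OF anti] card_cut_le[of w] by simp
  thus ?thesis
    unfolding af_def using anti lower by (intro Least_equality) auto
qed

lemma Af_H_eq: "Af_H n = (\<Sum>w \<in> words n. monom 1 (word_weight w))"
proof (cases "n = 0")
  case True
  have "pyrene_E 0 = {}" by (simp add: pyrene_E_def pyrene_centres_eq)
  moreover have "pyrene_V 0 = {}" using calculation by (simp add: pyrene_V_def)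
  moreover have pm: "perfect_matchings {} {} = {{} :: edge set}"
    by (auto simp: perfect_matchings_def perfect_matching_def)
  moreover have "af {} {} ({} :: edge set) = 0"
    unfolding af_def by (rule Least_equality) (auto simp: anti_forcing_set_def pm)
  moreover have "words 0 = {[]}" by (auto simp: words_def admissible_def)
  ultimately show ?thesis using True
    by (simp add: Af_H_def anti_forcing_poly_def)
next
  case False
  hence n: "n > 0" by simp
  show ?thesis
    unfolding Af_H_def anti_forcing_poly_def perfect_matchings_pyrene[OF n]
      sum.reindex[OF inj_on_word_matching] o_def
    using af_word[OF n] by (intro sum.cong) auto
qed

section \<open>Counting words\<close>

lemma UNIV_frag:
  "(UNIV :: frag set) = {Lft, Rgt, Mid True True, Mid True False, Mid False True, Mid False False}"
proof -
  have "c \<in> {Lft, Rgt, Mid True True, Mid True False, Mid False True, Mid False False}" for c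
    by (cases c) auto
  thus ?thesis by blast
qed

lemma finite_words: "finite (words n)"
proof -
  have "finite (UNIV :: frag set)" unfolding UNIV_frag by simp
  from finite_lists_length_eq[OF this, of n] show ?thesis
    by (rule rev_finite_subset) (auto simp: words_def)
qed

lemma sum_frag_weight: "(\<Sum>c \<in> UNIV. monom 1 (weight c)) = ([:0, 2, 2, 2:] :: int poly)"
  unfolding UNIV_frag by (simp add: monom_altdef numeral_eq_Suc)

lemma words_Suc_Suc:
  "words (Suc (Suc n)) =
     (\<lambda>(c, w). c # w) ` (UNIV \<times> words (Suc n)) - (\<lambda>w. Rgt # Lft # w) ` words n"
proof (rule set_eqI)
  fix w
  show "w \<in> words (Suc (Suc n)) \<longleftrightarrow>
     w \<in> (\<lambda>(c, w). c # w) ` (UNIV \<times> words (Suc n)) - (\<lambda>w. Rgt # Lft # w) ` words n"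
  proof (cases "length w = Suc (Suc n)")
    case True
    then obtain c d u where "w = c # d # u" "length u = n"
      by (auto simp: length_Suc_conv)
    thus ?thesis
      by (auto simp: words_def admissible_def successively_Cons image_iff)
  qed (auto simp: words_def)
qed

lemma word_sum_Suc_Suc:
  fixes F :: "nat \<Rightarrow> int poly"
  defines "F \<equiv> \<lambda>n. \<Sum>w \<in> words n. monom 1 (word_weight w)"
  shows "F (Suc (Suc n)) = [:0, 2, 2, 2:] * F (Suc n) - monom 1 2 * F n"
proof -
  let ?f = "\<lambda>w. monom (1 :: int) (word_weight w)"
  let ?A = "(\<lambda>(c, w). c # w) ` (UNIV \<times> words (Suc n))"
  let ?B = "(\<lambda>w. Rgt # Lft # w) ` words n"
  have fin: "finite ?A"
    using finite_words[of "Suc n"] by (simp add: UNIV_frag)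
  have sub: "?B \<subseteq> ?A"
  proof
    fix v assume "v \<in> ?B"
    then obtain w where w: "w \<in> words n" "v = Rgt # Lft # w" by blast
    hence "Lft # w \<in> words (Suc n)"
      by (auto simp: words_def admissible_def successively_Cons)
    with w show "v \<in> ?A" by force
  qed
  have "sum ?f ?A = (\<Sum>(c, w) \<in> UNIV \<times> words (Suc n). monom 1 (weight c) * ?f w)"
    by (subst sum.reindex) (auto simp: inj_on_def mult_monom intro!: sum.cong)
  also have "\<dots> = [:0, 2, 2, 2:] * F (Suc n)"
    unfolding sum_frag_weight[symmetric] F_def sum_product sum.cartesian_product ..
  finally have A: "sum ?f ?A = [:0, 2, 2, 2:] * F (Suc n)" .
  have B: "sum ?f ?B = monom 1 2 * F n"
    unfolding F_def sum_distrib_left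
    by (subst sum.reindex) (auto simp: inj_on_def mult_monom intro!: sum.cong)
  show ?thesis
    using sum_diff[OF fin sub, of ?f] A B unfolding words_Suc_Suc[symmetric] by (simp add: F_def)
qed

theorem theorem4p1:
  shows "Af_H 0 = 1 \<and> Af_H 1 = [:0, 2, 2, 2:] \<and>
    (\<forall>n\<ge>2. Af_H n = [:0, 2, 2, 2:] * Af_H (n - 1) - monom 1 2 * Af_H (n - 2))"
proof (intro conjI allI impI)
  have "words 0 = {[]}" by (auto simp: words_def admissible_def)
  thus "Af_H 0 = 1" by (simp add: Af_H_eq)
  have "words 1 = (\<lambda>c. [c]) ` UNIV"
    by (auto simp: words_def admissible_def length_Suc_conv)
  hence "Af_H 1 = (\<Sum>c \<in> UNIV. monom 1 (weight c))"
    by (simp add: Af_H_eq sum.reindex inj_on_def)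
  thus "Af_H 1 = [:0, 2, 2, 2:]" by (simp only: sum_frag_weight)
  fix n :: nat assume "n \<ge> 2"
  then obtain m where "n = Suc (Suc m)" by (metis add_2_eq_Suc le_Suc_ex)
  thus "Af_H n = [:0, 2, 2, 2:] * Af_H (n - 1) - monom 1 2 * Af_H (n - 2)"
    by (simp add: Af_H_eq word_sum_Suc_Suc)
qed

end
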